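(* Let $X$ be an Archimedean pervasive pre-Riesz space and let $a\in X$ be an atom. Then $X=\mathcal B_a\oplus\mathcal B_a^{\mathrm{d}}$.
   Context: All vector spaces are real. An ordered vector space $X$ is a real vector space with a cone $X_+$ (closed under addition and multiplication by nonnegative scalars, $X_+\cap(-X_+)=\{0\}$), ordered by $x\le y$ iff $y-x\in X_+$. It is Archimedean if $nx\le y$ for all $n\in\mathbb N$ implies $x\le 0$. A linear subspace $D$ of an ordered vector space $Y$ is order dense in $Y$ if $y=\inf\{z\in D: y\le z\}$ for every $y\in Y$. An ordered vector space $X$ is a pre-Riesz space if there exist a vector lattice $Y$ and a bipositive linear map $i\colon X\to Y$ (i.e. $i(x)\ge 0$ iff $x\ge 0$) such that $i(X)$ is order dense in $Y$; then $(Y,i)$ is called a vector lattice cover of $X$. A pre-Riesz space $X$ is pervasive if for some (equivalently, every) vector lattice cover $(Y,i)$ of $X$, for every $y\in Y_+$ with $y\ne 0$ there is $x\in X$ with $0<i(x)\le y$. For $M\subseteq X$, $M^u$ is the set of upper bounds of $M$ in $X$. Elements $x,y\in X$ are disjoint, $x\perp y$, if $\{x+y,-x-y\}^u=\{x-y,-x+y\}^u$. The disjoint complement of $M\subseteq X$ is $M^{\mathrm{d}}=\{x\in X: x\perp y\text{ for all }y\in M\}$, and $M^{\mathrm{dd}}=(M^{\mathrm{d}})^{\mathrm{d}}$. A linear subspace $B$ is a band if $B^{\mathrm{dd}}=B$. $\mathcal B_a$ is the intersection of all bands in $X$ containing $a$; one has $\mathcal B_a=\{a\}^{\mathrm{dd}}$.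 An element $a\in X_+\setminus\{0\}$ is an atom if $0\le x\le a$ implies $x=\lambda a$ for some real $\lambda\ge 0$. *)

theory Defs
  imports Complex_Main "HOL-Library.Lub_Glb"
begin

text \<open>
  An ordered vector space is a type of class \<open>ordered_real_vector\<close>, with cone \<open>{x. 0 \<le> x}\<close>;
  a vector lattice is a type of sort \<open>{ordered_real_vector, lattice}\<close>.
\<close>

definition archimedean_ordered_vector :: "'a::ordered_real_vector itself \<Rightarrow> bool" where
  "archimedean_ordered_vector _ \<longleftrightarrow>
     (\<forall>x y :: 'a. (\<forall>n::nat. of_nat n *\<^sub>R x \<le> y) \<longrightarrow> x \<le> 0)"

definition order_dense :: "'a::ordered_real_vector set \<Rightarrow> bool" where
  "order_dense D \<longleftrightarrow> subspace D \<and> (\<forall>y. isGlb UNIV {z \<in> D. y \<le> z} y)"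

definition bipositive :: "('a::ordered_real_vector \<Rightarrow> 'b::ordered_real_vector) \<Rightarrow> bool" where
  "bipositive i \<longleftrightarrow> (\<forall>x. 0 \<le> i x \<longleftrightarrow> 0 \<le> x)"

text \<open>
  HOL cannot quantify existentially over types, so there is no predicate on \<open>'a\<close> alone saying that
  some vector lattice cover exists. The cover is an explicit map \<open>i\<close> into an arbitrary type \<open>'b\<close>:
  a theorem assuming \<open>vector_lattice_cover i\<close> for a schematic \<open>'b\<close> and \<open>i\<close> covers every
  pre-Riesz space \<open>'a\<close>, whatever its vector lattice covers are.
\<close>

definition vector_lattice_cover ::
    "('a::ordered_real_vector \<Rightarrow> 'b::{ordered_real_vector, lattice}) \<Rightarrow> bool" where
  "vector_lattice_cover i \<longleftrightarrow> linear i \<and> bipositive i \<and> order_dense (range i)"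

definition pervasive_in_cover ::
    "('a::ordered_real_vector \<Rightarrow> 'b::{ordered_real_vector, lattice}) \<Rightarrow> bool" where
  "pervasive_in_cover i \<longleftrightarrow> (\<forall>y. 0 \<le> y \<and> y \<noteq> 0 \<longrightarrow> (\<exists>x. 0 < i x \<and> i x \<le> y))"

definition upper_bounds :: "'a::ordered_real_vector set \<Rightarrow> 'a set" where
  "upper_bounds M = {u. \<forall>m\<in>M. m \<le> u}"

definition disjoint_elems :: "'a::ordered_real_vector \<Rightarrow> 'a \<Rightarrow> bool" where
  "disjoint_elems x y \<longleftrightarrow> upper_bounds {x + y, - x - y} = upper_bounds {x - y, - x + y}"

definition disjoint_complement :: "'a::ordered_real_vector set \<Rightarrow> 'a set" where
  "disjoint_complement M = {x. \<forall>y\<in>M. disjoint_elems x y}"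

definition band :: "'a::ordered_real_vector set \<Rightarrow> bool" where
  "band B \<longleftrightarrow> subspace B \<and> disjoint_complement (disjoint_complement B) = B"

definition principal_band :: "'a::ordered_real_vector \<Rightarrow> 'a set" where
  "principal_band a = \<Inter>{B. band B \<and> a \<in> B}"

definition atom :: "'a::ordered_real_vector \<Rightarrow> bool" where
  "atom a \<longleftrightarrow> 0 \<le> a \<and> a \<noteq> 0 \<and>
     (\<forall>x. 0 \<le> x \<and> x \<le> a \<longrightarrow> (\<exists>c::real. 0 \<le> c \<and> x = c *\<^sub>R a))"

definition is_direct_sum :: "'a::real_vector set \<Rightarrow> 'a set \<Rightarrow> bool" where
  "is_direct_sum U V \<longleftrightarrow>
     subspace U \<and> subspace V \<and> U \<inter> V = {0} \<and> {u + v | u v. u \<in> U \<and> v \<in> V} = UNIV"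

end

theory Submission
  imports Defs "HOL-Library.Lattice_Algebras"
begin

text \<open>
  The point is that every positive \<open>x\<close> splits as \<open>x = c a + r\<close> with \<open>r\<close> disjoint from the atom \<open>a\<close>.
  Take for \<open>c\<close> the largest real with \<open>c a \<le> x\<close>; it exists because the space is Archimedean. If the
  infimum of \<open>i (x - c a)\<close> and \<open>i a\<close> in the cover were not zero, then pervasiveness would give an
  element \<open>z\<close> with \<open>0 < i z\<close> below that infimum. Then \<open>0 < z \<le> a\<close>, so \<open>z = d a\<close> with \<open>d > 0\<close>, and
  \<open>(c + d) a \<le> x\<close> contradicts the choice of \<open>c\<close>. As the cone is generating, every \<open>x\<close> splits in
  this way.

  Disjointness of \<open>x\<close> and \<open>y\<close> is equivalent to \<open>\<bar>i x\<bar> \<sqinter> \<bar>i y\<bar> = 0\<close> in the cover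
  (\<open>disjoint_elems_iff_cover\<close>), so disjoint complements are linear subspaces. Hence
  \<open>{a}\<^sup>d\<^sup>d\<close> is the band generated by \<open>a\<close>, its disjoint complement is \<open>{a}\<^sup>d\<close>, and
  the splitting above shows that the two span the space; they meet only in \<open>0\<close>, because only \<open>0\<close> is
  disjoint from itself.
\<close>

section \<open>The modulus in a vector lattice\<close>

text \<open>The modulus \<open>\<bar>u\<bar> = u \<squnion> - u\<close>.\<close>

definition vmod :: "'b::{ordered_real_vector, lattice} \<Rightarrow> 'b" where
  "vmod u = sup u (- u)"

text \<open>
  The sort \<open>{ordered_real_vector, lattice}\<close> has no \<open>abs\<close>; the interpretation provides the
  theory of lattice-ordered groups with \<open>vmod\<close> as absolute value.
\<close>

interpretation vl: lattice_ab_group_add_abs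
  vmod "(+)" "0 :: 'b::{ordered_real_vector, lattice}" "(-)" uminus "(\<le>)" "(<)" inf sup
  by unfold_locales (simp_all add: vmod_def)

lemma vmod_le_iff: "vmod u \<le> w \<longleftrightarrow> u \<le> w \<and> - u \<le> w"
  by (simp add: vmod_def)

lemma vmod_scaleR_le:
  assumes "\<bar>c\<bar> \<le> k"
  shows "vmod (c *\<^sub>R u) \<le> k *\<^sub>R vmod u"
proof -
  have "c *\<^sub>R u \<le> \<bar>c\<bar> *\<^sub>R vmod u" for c
  proof (cases "0 \<le> c")
    case True
    then show ?thesis
      using scaleR_left_mono[OF vl.abs_ge_self[of u], of c] by simp
  next
    case False
    then show ?thesis
      using scaleR_left_mono[OF vl.abs_ge_minus_self[of u], of "- c"] by simp
  qed
  from this[of c] this[of "- c"] have "vmod (c *\<^sub>R u) \<le> \<bar>c\<bar> *\<^sub>R vmod u"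
    by (simp add: vmod_le_iff)
  also have "\<dots> \<le> k *\<^sub>R vmod u"
    using assms by (intro scaleR_right_mono) auto
  finally show ?thesis .
qed

text \<open>
  The instance of distributivity that is needed below: \<open>x \<sqinter> (y \<squnion> z) = (x \<sqinter> y) \<squnion> (x \<sqinter> z)\<close>
  holds in every lattice-ordered group.
\<close>

lemma inf_sup_le_zero:
  fixes x y z :: "'b::{ordered_real_vector, lattice}"
  assumes "inf x y \<le> 0" and "inf x z \<le> 0"
  shows "inf x (sup y z) \<le> 0"
proof -
  have *: "x + w \<le> sup x (sup y z)" if "inf x w \<le> 0" and "w \<le> sup y z" for w
  proof -
    have "x + w = sup x w + inf x w"
      by (rule vl.add_eq_inf_sup)
    also have "\<dots> \<le> sup x w"
      using that(1) by simp
    also have "\<dots> \<le> sup x (sup y z)"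
      using that(2) by (intro sup_mono) auto
    finally show ?thesis .
  qed
  have "x + sup y z = sup (x + y) (x + z)"
    by (rule vl.add_sup_distrib_left)
  also have "\<dots> \<le> sup x (sup y z)"
    using *[OF assms(1)] *[OF assms(2)] by simp
  finally have "sup x (sup y z) + inf x (sup y z) \<le> sup x (sup y z)"
    by (subst (asm) vl.add_eq_inf_sup)
  then show ?thesis
    by simp
qed

text \<open>This rests on \<open>\<bar>u - v\<bar> = u + v - 2 (u \<sqinter> v)\<close>.\<close>

lemma inf_le_zero_iff:
  fixes u v :: "'b::{ordered_real_vector, lattice}"
  shows "inf u v \<le> 0 \<longleftrightarrow> u + v \<le> vmod (u - v)"
proof -
  have 1: "u - v \<le> vmod (u - v)" and 2: "- (u - v) \<le> vmod (u - v)"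
    by (rule vl.abs_ge_self vl.abs_ge_minus_self)+
  show ?thesis
  proof
    assume "inf u v \<le> 0"
    have "0 \<le> vmod (u - v)"
      by (rule vl.abs_ge_zero)
    then have "sup u v \<le> inf (u + vmod (u - v)) (v + vmod (u - v))"
      using 1 2 by (simp add: algebra_simps)
    also have "\<dots> = inf u v + vmod (u - v)"
      by (rule vl.add_inf_distrib_right[symmetric])
    also have "\<dots> \<le> vmod (u - v)"
      using \<open>inf u v \<le> 0\<close> by (rule add_decreasing) (rule order_refl)
    finally have "sup u v + inf u v \<le> vmod (u - v)"
      using \<open>inf u v \<le> 0\<close> by (rule add_decreasing2[rotated])
    then show "u + v \<le> vmod (u - v)"
      by (subst vl.add_eq_inf_sup)
  next
    let ?p = "inf u v"
    assume "u + v \<le> vmod (u - v)"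
    moreover have "vmod (u - v) \<le> u + v - (?p + ?p)"
    proof -
      have "?p + ?p \<le> u + u" "?p + ?p \<le> v + v"
        by (simp_all add: add_mono)
      from diff_left_mono[OF this(1), of "u + v"] diff_left_mono[OF this(2), of "u + v"]
      show ?thesis
        by (simp add: vmod_le_iff)
    qed
    ultimately have "u + v \<le> u + v - (?p + ?p)"
      by (rule order_trans)
    then have "?p + ?p \<le> 0"
      by (simp only: le_diff_eq add_le_same_cancel1)
    then show "?p \<le> 0"
      by simp
  qed
qed

section \<open>Disjointness in a vector lattice\<close>

lemma inf_vmod_eq_zero_iff: "inf (vmod u) (vmod v) = 0 \<longleftrightarrow> inf (vmod u) (vmod v) \<le> 0"
proof -
  have "0 \<le> inf (vmod u) (vmod v)"
    by (intro le_infI vl.abs_ge_zero)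
  then show ?thesis
    by (metis order_antisym order_refl)
qed

text \<open>
  By distributivity, \<open>\<bar>u\<bar> \<sqinter> \<bar>v\<bar> \<le> 0\<close> splits into four conditions \<open>\<plusminus>u \<sqinter> \<plusminus>v \<le> 0\<close>; two of
  them say \<open>\<bar>u + v\<bar> \<le> \<bar>u - v\<bar>\<close>, the other two the reverse.
\<close>

lemma inf_vmod_eq_zero_iff_vmod_add_eq:
  "inf (vmod u) (vmod v) = 0 \<longleftrightarrow> vmod (u + v) = vmod (u - v)"
proof -
  have "inf (vmod u) (vmod v) \<le> 0 \<longleftrightarrow>
      inf u v \<le> 0 \<and> inf (- u) (- v) \<le> 0 \<and> inf u (- v) \<le> 0 \<and> inf (- u) v \<le> 0"
    (is "?L \<longleftrightarrow> ?R")
  proof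
    have "inf s t \<le> inf (vmod u) (vmod v)" if "s \<in> {u, - u}" "t \<in> {v, - v}" for s t
      using that by (intro inf_mono) (auto simp: vmod_def)
    then show "?R" if "?L"
      using that by (meson insertI1 insertI2 order_trans)
  next
    assume ?R
    then have "inf u (vmod v) \<le> 0" "inf (- u) (vmod v) \<le> 0"
      by (simp_all add: vmod_def inf_sup_le_zero)
    then show ?L
      unfolding vmod_def[of u] by (metis inf_commute inf_sup_le_zero)
  qed
  also have "\<dots> \<longleftrightarrow> vmod (u + v) \<le> vmod (u - v) \<and> vmod (u - v) \<le> vmod (u + v)"
  proof -
    have "vmod (v - u) = vmod (u - v)" "vmod (- u - v) = vmod (u + v)"
      using vl.abs_minus_cancel[of "u - v"] vl.abs_minus_cancel[of "u + v"] by simp_all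
    then show ?thesis
      by (auto simp: inf_le_zero_iff vmod_le_iff[of "u + v"] vmod_le_iff[of "u - v"])
  qed
  finally show ?thesis
    by (auto simp: inf_vmod_eq_zero_iff)
qed

lemma inf_vmod_add_eq_zero:
  assumes "inf (vmod u) (vmod v) = 0" and "inf (vmod u') (vmod v) = 0"
  shows "inf (vmod (u + u')) (vmod v) = 0"
proof -
  let ?p = "inf (vmod (u + u')) (vmod v)"
  have v: "?p \<le> vmod v + w" if "0 \<le> w" for w
    using that by (intro order_trans[OF inf_le2]) simp
  have "?p \<le> vmod u + vmod u'"
    by (rule order_trans[OF inf_le1 vl.abs_triangle_ineq])
  moreover have "?p \<le> vmod u + vmod v"
    using v[of "vmod u"] by (simp add: add.commute)
  ultimately have "?p \<le> inf (vmod u) (vmod v) + inf (vmod u') (vmod v)"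
    using v[of "vmod u'"] v[of "vmod v"]
    by (simp add: vl.add_inf_distrib_left vl.add_inf_distrib_right add.commute)
  then have "?p \<le> 0"
    by (simp only: assms add_0_left)
  then show ?thesis
    by (rule iffD2[OF inf_vmod_eq_zero_iff])
qed

lemma inf_vmod_scaleR_eq_zero:
  assumes "inf (vmod u) (vmod v) = 0"
  shows "inf (vmod (c *\<^sub>R u)) (vmod v) = 0"
proof -
  define k where "k = max 1 \<bar>c\<bar>"
  let ?p = "inf (vmod (c *\<^sub>R u)) (vmod v)"
  have k: "0 < k" "1 \<le> k" "\<bar>c\<bar> \<le> k"
    by (auto simp: k_def)
  have "?p \<le> k *\<^sub>R vmod u"
    by (rule order_trans[OF inf_le1 vmod_scaleR_le[OF k(3)]])
  moreover have "?p \<le> k *\<^sub>R vmod v"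
    using scaleR_right_mono[OF k(2), of "vmod v"] by (intro order_trans[OF inf_le2]) simp
  ultimately have "?p /\<^sub>R k \<le> inf (vmod u) (vmod v)"
    using k(1) by (simp add: pos_divideR_le_eq)
  then have "?p \<le> 0"
    using assms k(1) by (simp add: pos_divideR_le_eq)
  then show ?thesis
    by (rule iffD2[OF inf_vmod_eq_zero_iff])
qed

section \<open>Disjoint complements in a pre-Riesz space\<close>

lemma disjoint_elems_sym: "disjoint_elems x y \<longleftrightarrow> disjoint_elems y x"
proof -
  have "{x + y, - x - y} = {y + x, - y - x}" "{x - y, - x + y} = {y - x, - y + x}"
    by auto
  then show ?thesis
    by (simp add: disjoint_elems_def)
qed

lemma disjoint_elems_self_imp_zero:
  assumes "disjoint_elems x x"
  shows "x = 0"
proof -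
  have "0 \<in> upper_bounds {x + x, - x - x}"
    using assms by (simp add: disjoint_elems_def upper_bounds_def)
  then have "x + x \<le> 0" and "- (x + x) \<le> 0"
    by (simp_all add: upper_bounds_def)
  then have "x + x = 0"
    by (intro order_antisym) (simp_all only: neg_le_0_iff_le)
  then have "2 *\<^sub>R x = 0"
    by (simp add: scaleR_2)
  then show ?thesis
    by simp
qed

lemma disjoint_complement_antimono:
  "M \<subseteq> N \<Longrightarrow> disjoint_complement N \<subseteq> disjoint_complement M"
  by (auto simp: disjoint_complement_def)

lemma subset_double_disjoint_complement:
  "M \<subseteq> disjoint_complement (disjoint_complement M)"
  unfolding disjoint_complement_def by (auto intro: iffD1[OF disjoint_elems_sym])

lemma triple_disjoint_complement:
  "disjoint_complement (disjoint_complement (disjoint_complement M)) = disjoint_complement M"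
  by (rule equalityI[OF disjoint_complement_antimono[OF subset_double_disjoint_complement]
        subset_double_disjoint_complement])

context
  fixes i :: "'a::ordered_real_vector \<Rightarrow> 'b::{ordered_real_vector, lattice}"
  assumes cover: "vector_lattice_cover i"
begin

lemma linear_cover: "linear i"
  using cover by (simp add: vector_lattice_cover_def)

lemma cover_le_iff: "i x \<le> i y \<longleftrightarrow> x \<le> y"
proof -
  have "0 \<le> i (y - x) \<longleftrightarrow> 0 \<le> y - x"
    using cover by (simp add: vector_lattice_cover_def bipositive_def)
  then show ?thesis
    by (simp add: linear_diff[OF linear_cover])
qed

lemma cover_less_iff: "i x < i y \<longleftrightarrow> x < y"
  by (simp add: less_le_not_le cover_le_iff)

lemma cover_le_if_upper_bounds:
  assumes "\<And>z. v \<le> i z \<Longrightarrow> u \<le> i z"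
  shows "u \<le> v"
proof (rule isGlb_le_isLb)
  show "isGlb UNIV {z \<in> range i. v \<le> z} v"
    using cover by (simp add: vector_lattice_cover_def order_dense_def)
  show "isLb UNIV {z \<in> range i. v \<le> z} u"
    using assms by (auto simp: isLb_def setge_def)
qed

lemma cover_upper_bound_exists: "\<exists>z. y \<le> i z"
proof (rule ccontr)
  assume none: "\<nexists>z. y \<le> i z"
  \<comment> \<open>Then every element of the cover is a lower bound of the empty set of elements above \<open>y\<close>.\<close>
  then have "y + y \<le> y"
    by (metis cover_le_if_upper_bounds)
  then have "y \<le> i 0"
    by (simp add: linear_0[OF linear_cover])
  with none show False
    by blast
qed

lemma positive_upper_bound_exists: "\<exists>z. 0 \<le> z \<and> (x :: 'a) \<le> z"
proof -
  obtain z where "sup (i 0) (i x) \<le> i z"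
    using cover_upper_bound_exists by blast
  then show ?thesis
    by (auto simp: cover_le_iff)
qed

text \<open>
  By order density, \<open>\<bar>i x + i y\<bar> = \<bar>i x - i y\<bar>\<close> holds as soon as both sides have the same
  upper bounds in the range of \<open>i\<close>.
\<close>

lemma disjoint_elems_iff_cover:
  "disjoint_elems x y \<longleftrightarrow> inf (vmod (i x)) (vmod (i y)) = 0"
proof -
  have "i (x + y) = i x + i y" "i (- x - y) = - (i x + i y)"
    "i (x - y) = i x - i y" "i (- x + y) = - (i x - i y)"
    by (simp_all add: linear_add[OF linear_cover] linear_diff[OF linear_cover]
        linear_neg[OF linear_cover])
  then have 1: "z \<in> upper_bounds {x + y, - x - y} \<longleftrightarrow> vmod (i x + i y) \<le> i z"
    and 2: "z \<in> upper_bounds {x - y, - x + y} \<longleftrightarrow> vmod (i x - i y) \<le> i z" for z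
    unfolding vmod_le_iff upper_bounds_def cover_le_iff[symmetric] by simp_all
  have "disjoint_elems x y \<longleftrightarrow> (\<forall>z. vmod (i x + i y) \<le> i z \<longleftrightarrow> vmod (i x - i y) \<le> i z)"
    unfolding disjoint_elems_def set_eq_iff 1 2 ..
  also have "\<dots> \<longleftrightarrow> vmod (i x + i y) = vmod (i x - i y)"
    by (metis order_antisym cover_le_if_upper_bounds)
  finally show ?thesis
    by (simp add: inf_vmod_eq_zero_iff_vmod_add_eq)
qed

lemma subspace_disjoint_complement: "subspace (disjoint_complement (M :: 'a set))"
  by (auto simp: subspace_def disjoint_complement_def disjoint_elems_iff_cover
      linear_0[OF linear_cover] linear_add[OF linear_cover] linear_scale[OF linear_cover]
      inf_vmod_add_eq_zero inf_vmod_scaleR_eq_zero inf_absorb1)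

lemma principal_band_eq_double_complement:
  "principal_band (b :: 'a) = disjoint_complement (disjoint_complement {b})"
proof
  have "band (disjoint_complement (disjoint_complement {b}))"
    by (simp add: band_def triple_disjoint_complement subspace_disjoint_complement)
  then show "principal_band b \<subseteq> disjoint_complement (disjoint_complement {b})"
    using subset_double_disjoint_complement[of "{b}"] by (auto simp: principal_band_def)
next
  have "disjoint_complement (disjoint_complement {b}) \<subseteq> B" if "band B" "b \<in> B" for B
  proof -
    have "disjoint_complement (disjoint_complement {b})
        \<subseteq> disjoint_complement (disjoint_complement B)"
      using that(2) by (intro disjoint_complement_antimono) simp
    then show ?thesis
      using that(1) by (simp add: band_def)
  qed
  then show "disjoint_complement (disjoint_complement {b}) \<subseteq> principal_band b"
    by (auto simp: principal_band_def)
qed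

end

section \<open>Splitting off multiples of an atom\<close>

lemma archimedean_largest_multiple:
  fixes a x :: "'a::ordered_real_vector"
  assumes arch: "archimedean_ordered_vector TYPE('a)"
    and a: "0 \<le> a" "a \<noteq> 0" and x: "0 \<le> x"
  obtains c where "c *\<^sub>R a \<le> x" "\<And>d. d *\<^sub>R a \<le> x \<Longrightarrow> d \<le> c"
proof -
  define S where "S = {c::real. c *\<^sub>R a \<le> x}"
  have "0 \<in> S"
    using x by (simp add: S_def)
  have "\<not> a \<le> 0"
    using a by auto
  then obtain n :: nat where n: "\<not> of_nat n *\<^sub>R a \<le> x"
    using arch unfolding archimedean_ordered_vector_def by blast
  have "c \<le> of_nat n" if "c \<in> S" for c
  proof (rule ccontr)
    assume "\<not> c \<le> of_nat n"
    then have "of_nat n *\<^sub>R a \<le> c *\<^sub>R a"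
      using a(1) by (intro scaleR_right_mono) auto
    with that n show False
      unfolding S_def using order_trans by blast
  qed
  then have bdd: "bdd_above S"
    by (rule bdd_aboveI)
  define c where "c = Sup S"
  \<comment> \<open>The supremum is attained: \<open>n (c a - x) \<le> a\<close> for every \<open>n\<close>.\<close>
  have "of_nat m *\<^sub>R (c *\<^sub>R a - x) \<le> a" for m :: nat
  proof (cases "m = 0")
    case True
    then show ?thesis
      using a(1) by simp
  next
    case False
    then have "c - 1 / m < Sup S"
      by (simp add: c_def)
    then obtain d where d: "d \<in> S" "c - 1 / m < d"
      using less_cSup_iff[OF _ bdd] \<open>0 \<in> S\<close> by blast
    have "c *\<^sub>R a - x \<le> c *\<^sub>R a - d *\<^sub>R a"
      using d(1) by (simp add: S_def)
    also have "\<dots> = (c - d) *\<^sub>R a"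
      by (simp add: scaleR_left_diff_distrib)
    also have "\<dots> \<le> (1 / m) *\<^sub>R a"
      using d(2) a(1) by (intro scaleR_right_mono) auto
    finally have "real m *\<^sub>R (c *\<^sub>R a - x) \<le> real m *\<^sub>R (1 / m) *\<^sub>R a"
      by (rule scaleR_left_mono) simp
    then show ?thesis
      using False by simp
  qed
  then have "c *\<^sub>R a - x \<le> 0"
    using arch unfolding archimedean_ordered_vector_def by blast
  then have "c *\<^sub>R a \<le> x"
    by simp
  moreover have "d \<le> c" if "d *\<^sub>R a \<le> x" for d
    using that cSup_upper[OF _ bdd, of d] by (simp add: S_def c_def)
  ultimately show ?thesis
    using that by blast
qed

lemma atom_splitting_positive:
  fixes i :: "'a::ordered_real_vector \<Rightarrow> 'b::{ordered_real_vector, lattice}"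
    and a x :: 'a
  assumes arch: "archimedean_ordered_vector TYPE('a)"
    and cover: "vector_lattice_cover i" and perv: "pervasive_in_cover i"
    and atom: "atom a" and x: "0 \<le> x"
  shows "\<exists>c. x - c *\<^sub>R a \<in> disjoint_complement {a}"
proof -
  have a: "0 \<le> a" "a \<noteq> 0"
    using atom by (auto simp: atom_def)
  obtain c where c: "c *\<^sub>R a \<le> x" "\<And>d. d *\<^sub>R a \<le> x \<Longrightarrow> d \<le> c"
    using archimedean_largest_multiple[OF arch a x] by blast
  define r where "r = x - c *\<^sub>R a"
  have i0: "i 0 = 0"
    by (rule linear_0[OF linear_cover[OF cover]])
  have pos: "0 \<le> i r" "0 \<le> i a"
    using c(1) a(1) cover_le_iff[OF cover, of 0] by (simp_all add: i0 r_def)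
  have "inf (i r) (i a) = 0"
  proof (rule ccontr)
    assume "inf (i r) (i a) \<noteq> 0"
    moreover have "0 \<le> inf (i r) (i a)"
      using pos by simp
    ultimately obtain z where "0 < i z" "i z \<le> inf (i r) (i a)"
      using perv unfolding pervasive_in_cover_def by blast
    then have z: "0 < z" "z \<le> r" "z \<le> a"
      using cover_less_iff[OF cover, of 0 z] by (simp_all add: i0 cover_le_iff[OF cover])
    then obtain d where d: "0 \<le> d" "z = d *\<^sub>R a"
      using atom unfolding atom_def by (meson less_imp_le)
    have "(c + d) *\<^sub>R a \<le> x"
      using z(2) by (simp add: d(2) r_def scaleR_left_distrib le_diff_eq add.commute)
    with c(2) have "d \<le> 0"
      by fastforce
    with d z(1) show False
      by simp
  qed
  then have "r \<in> disjoint_complement {a}"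
    using pos by (simp add: disjoint_complement_def disjoint_elems_iff_cover[OF cover])
  then show ?thesis
    by (auto simp: r_def)
qed

lemma atom_splitting:
  fixes i :: "'a::ordered_real_vector \<Rightarrow> 'b::{ordered_real_vector, lattice}"
    and a x :: 'a
  assumes "archimedean_ordered_vector TYPE('a)"
    and cover: "vector_lattice_cover i" and "pervasive_in_cover i"
    and "atom a"
  shows "\<exists>c. x - c *\<^sub>R a \<in> disjoint_complement {a}"
proof -
  obtain z where z: "0 \<le> z" "x \<le> z"
    using positive_upper_bound_exists[OF cover] by blast
  obtain c where c: "z - c *\<^sub>R a \<in> disjoint_complement {a}"
    using atom_splitting_positive[OF assms z(1)] by blast
  obtain d where d: "(z - x) - d *\<^sub>R a \<in> disjoint_complement {a}"
    using atom_splitting_positive[OF assms, of "z - x"] z(2) by auto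
  have "(z - c *\<^sub>R a) - ((z - x) - d *\<^sub>R a) \<in> disjoint_complement {a}"
    using subspace_diff[OF subspace_disjoint_complement[OF cover] c d] .
  also have "(z - c *\<^sub>R a) - ((z - x) - d *\<^sub>R a) = x - (c - d) *\<^sub>R a"
    by (simp add: algebra_simps)
  finally show ?thesis ..
qed

theorem theorem43:
  fixes i :: "'a::ordered_real_vector \<Rightarrow> 'b::{ordered_real_vector, lattice}"
    and a :: 'a
  assumes "archimedean_ordered_vector TYPE('a)"
    and "vector_lattice_cover i"
    and "pervasive_in_cover i"
    and "atom a"
  shows "is_direct_sum (principal_band a) (disjoint_complement (principal_band a))"
proof -
  note cover = assms(2)
  let ?V = "disjoint_complement {a}" and ?U = "disjoint_complement (disjoint_complement {a})"
  have sub: "subspace ?U" "subspace ?V"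
    by (rule subspace_disjoint_complement[OF cover])+
  have "?U \<inter> ?V = {0}"
  proof
    show "?U \<inter> ?V \<subseteq> {0}"
      using disjoint_elems_self_imp_zero by (auto simp: disjoint_complement_def[of ?V])
    show "{0} \<subseteq> ?U \<inter> ?V"
      using sub by (simp add: subspace_0)
  qed
  moreover have "\<exists>u v. x = u + v \<and> u \<in> ?U \<and> v \<in> ?V" for x
  proof -
    obtain c where "x - c *\<^sub>R a \<in> ?V"
      using atom_splitting[OF assms] by blast
    moreover have "c *\<^sub>R a \<in> ?U"
      using subset_double_disjoint_complement[of "{a}"] sub(1) by (simp add: subspace_scale)
    ultimately show ?thesis
      by (intro exI[of _ "c *\<^sub>R a"] exI[of _ "x - c *\<^sub>R a"]) simp
  qed
  ultimately have "is_direct_sum ?U ?V"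
    using sub unfolding is_direct_sum_def by blast
  then show ?thesis
    by (simp add: principal_band_eq_double_complement[OF cover] triple_disjoint_complement)
qed

end
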